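(* Every connected harmonic-uniform graph on at least three vertices with diameter at most $3$ is $2$-connected.
   Context: Graphs are finite, without loops or multiple edges. For a connected graph $G$, $d(u,v)$ denotes the distance (length of a shortest $u$-$v$-path). The harmonic centrality of a vertex $x$ of $G$ is $H_G(x)=\sum_{u\in V(G),\,u\neq x}\frac{1}{d(u,x)}$. The harmonic center $\mathcal{C}_H(G)$ is the subgraph of $G$ induced by the vertices with maximum harmonic centrality. $G$ is harmonic-uniform if $\mathcal{C}_H(G)\cong G$, i.e. all vertices of $G$ have the same harmonic centrality. *)

theory Defs
  imports "Graph_Theory.Graph_Theory"
begin

text \<open>
  A finite simple undirected graph is a digraph satisfying \<^locale>\<open>graph\<close>: finite, loop-free,
  without parallel arcs and symmetric, each undirected edge being a pair of opposite arcs.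
\<close>

definition graph_dist :: "('a, 'b) pre_digraph \<Rightarrow> 'a \<Rightarrow> 'a \<Rightarrow> ereal" where
  "graph_dist G u v = wf_digraph.\<mu> G (\<lambda>_. 1) u v"

definition graph_diameter :: "('a, 'b) pre_digraph \<Rightarrow> ereal" where
  "graph_diameter G = (SUP u\<in>verts G. SUP v\<in>verts G. graph_dist G u v)"

text \<open>
  All distances in a finite connected graph are finite, so the conversion to
  real numbers loses nothing there.
\<close>
definition harmonic_centrality :: "('a, 'b) pre_digraph \<Rightarrow> 'a \<Rightarrow> real" where
  "harmonic_centrality G x = (\<Sum>u\<in>verts G - {x}. 1 / real_of_ereal (graph_dist G u x))"

definition harmonic_center :: "('a, 'b) pre_digraph \<Rightarrow> ('a, 'b) pre_digraph" where
  "harmonic_center G =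
     G \<restriction> {x \<in> verts G. \<forall>y\<in>verts G. harmonic_centrality G y \<le> harmonic_centrality G x}"

definition harmonic_uniform :: "('a, 'b) pre_digraph \<Rightarrow> bool" where
  "harmonic_uniform G \<longleftrightarrow> digraph_iso (harmonic_center G) G"

lemma harmonic_uniform_iff:
  assumes "graph G"
  shows "harmonic_uniform G \<longleftrightarrow>
    (\<forall>x\<in>verts G. \<forall>y\<in>verts G. harmonic_centrality G x = harmonic_centrality G y)"
proof -
  interpret graph G by fact
  let ?S = "{x \<in> verts G. \<forall>y\<in>verts G. harmonic_centrality G y \<le> harmonic_centrality G x}"
  have "digraph_iso (G \<restriction> ?S) G \<longleftrightarrow> ?S = verts G"
  proof
    assume "digraph_iso (G \<restriction> ?S) G"
    then obtain f where "pre_digraph.digraph_isomorphism (G \<restriction> ?S) f" "G = app_iso f (G \<restriction> ?S)"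
      unfolding digraph_iso_def by blast
    then have "verts G = iso_verts f ` ?S"
      using verts_app_iso[of f "G \<restriction> ?S"] by (simp only: induce_subgraph_verts)
    moreover have "card (iso_verts f ` ?S) \<le> card ?S"
      by (intro card_image_le) auto
    ultimately have "card (verts G) \<le> card ?S"
      by (simp only:)
    then show "?S = verts G"
      by (intro card_seteq) auto
  next
    assume S: "?S = verts G"
    have "G \<restriction> verts G = G"
      by (intro pre_digraph.equality) (auto simp: induce_subgraph_def)
    moreover have "digraph_iso G G"
      unfolding digraph_iso_def digraph_isomorphism_def app_iso_def
      by (intro exI[of _ "\<lparr>iso_verts = id, iso_arcs = id, iso_head = head G, iso_tail = tail G\<rparr>"])
        (auto intro: wf_digraph)
    ultimately show "digraph_iso (G \<restriction> ?S) G"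
      unfolding S by simp
  qed
  also have "?S = verts G \<longleftrightarrow>
    (\<forall>x\<in>verts G. \<forall>y\<in>verts G. harmonic_centrality G x = harmonic_centrality G y)"
  proof
    assume "?S = verts G"
    then show "\<forall>x\<in>verts G. \<forall>y\<in>verts G. harmonic_centrality G x = harmonic_centrality G y"
      by (blast intro: order_antisym)
  next
    assume "\<forall>x\<in>verts G. \<forall>y\<in>verts G. harmonic_centrality G x = harmonic_centrality G y"
    then show "?S = verts G"
      by (blast intro: eq_refl)
  qed
  finally show ?thesis
    unfolding harmonic_uniform_def harmonic_center_def .
qed

definition k_connected :: "nat \<Rightarrow> ('a, 'b) pre_digraph \<Rightarrow> bool" where
  "k_connected k G \<longleftrightarrow> k < card (verts G) \<and>
     (\<forall>X. X \<subseteq> verts G \<and> card X < k \<longrightarrow> connected (G \<restriction> (verts G - X)))"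

end

theory Submission
  imports Defs
begin

text \<open>
  Suppose that removing a vertex \<open>v\<close> splits the remaining vertices into two nonempty sides
  without edges between them. Every walk from one side to the other passes \<open>v\<close>, so the
  distance between vertices on different sides is at least the sum of their distances to \<open>v\<close>
  (\<open>graph_dist_separation\<close>). If both sides contained a vertex not adjacent to \<open>v\<close>, these two
  vertices would be at distance at least \<open>4\<close>; hence with diameter at most \<open>3\<close> one side, say
  \<open>A\<close>, consists of neighbours of \<open>v\<close> only (\<open>separation_side_adjacent\<close>).

  Compare \<open>v\<close> with some \<open>u\<close> in \<open>A\<close>. The other vertices of \<open>A\<close> are at distance \<open>1\<close> from \<open>v\<close>,
  so none of them is closer to \<open>u\<close>, while each vertex on the other side is strictly
  closer to \<open>v\<close> than to \<open>u\<close>. Hence \<open>v\<close> has strictly larger harmonic centrality than \<open>u\<close>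
  (\<open>harmonic_centrality_less_cutvertex\<close>), and the graph is not harmonic-uniform.
\<close>

section \<open>Unweighted distance\<close>

context wf_digraph
begin

lemma awalk_cost_one: "awalk_cost (\<lambda>_. 1) p = real (length p)"
  by (induct p) auto

lemma graph_dist_le_length: "awalk u p v \<Longrightarrow> graph_dist G u v \<le> real (length p)"
  unfolding graph_dist_def using min_cost_le_walk_cost[of u p v "\<lambda>_. 1"]
  by (simp add: awalk_cost_one)

lemma graph_dist_greatest:
  assumes "\<And>p. awalk u p v \<Longrightarrow> k \<le> ereal (real (length p))"
  shows "k \<le> graph_dist G u v"
  unfolding graph_dist_def \<mu>_def using assms by (auto intro!: INF_greatest simp: awalk_cost_one)

lemma graph_dist_ge_1:
  assumes "u \<noteq> v"
  shows "1 \<le> graph_dist G u v"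
proof (rule graph_dist_greatest)
  fix p assume "awalk u p v"
  with assms show "1 \<le> ereal (real (length p))"
    by (cases p) (auto simp: awalk_Nil_iff)
qed

lemma graph_dist_ge_2:
  assumes "u \<noteq> v" "\<not> u \<rightarrow>\<^bsub>G\<^esub> v"
  shows "2 \<le> graph_dist G u v"
proof (rule graph_dist_greatest)
  fix p assume p: "awalk u p v"
  have "2 \<le> length p"
  proof (rule ccontr)
    assume "\<not> 2 \<le> length p"
    then consider "p = []" | e where "p = [e]"
      by (cases p) (auto simp: not_le less_Suc_eq_0_disj numeral_2_eq_2)
    then show False
      using p assms by cases (auto simp: awalk_simps intro: in_arcs_imp_in_arcs_ends)
  qed
  then show "2 \<le> ereal (real (length p))" by simp
qed

lemma graph_dist_adjacent:
  assumes "u \<noteq> v" "u \<rightarrow>\<^bsub>G\<^esub> v"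
  shows "graph_dist G u v = 1"
proof (rule antisym)
  from assms(2) obtain e where "e \<in> arcs G" "u = tail G e" "v = head G e"
    by (auto simp: arcs_ends_conv)
  then have "awalk u [e] v"
    by (simp add: awalk_simps)
  from graph_dist_le_length[OF this] show "graph_dist G u v \<le> 1"
    by (simp add: one_ereal_def)
qed (use graph_dist_ge_1 assms in blast)

end

lemma (in fin_digraph) graph_dist_finite:
  assumes "u \<rightarrow>\<^sup>* v"
  shows "\<exists>d. graph_dist G u v = ereal d"
  using min_cost_awalk[OF assms, of "\<lambda>_. 1"] unfolding graph_dist_def by auto

section \<open>Separation by a vertex\<close>

text \<open>A side may consist of several components of the graph without \<open>v\<close>, so that a single
  disconnected pair of vertices yields a separation.\<close>
definition vertex_separation :: "('a, 'b) pre_digraph \<Rightarrow> 'a \<Rightarrow> 'a set \<Rightarrow> 'a set \<Rightarrow> bool" where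
  "vertex_separation G v A B \<longleftrightarrow>
     v \<in> verts G \<and> A \<noteq> {} \<and> B \<noteq> {} \<and> A \<inter> B = {} \<and> A \<union> B = verts G - {v} \<and>
     (\<forall>x\<in>A. \<forall>y\<in>B. \<not> x \<rightarrow>\<^bsub>G\<^esub> y \<and> \<not> y \<rightarrow>\<^bsub>G\<^esub> x)"

lemma vertex_separation_sym: "vertex_separation G v A B \<Longrightarrow> vertex_separation G v B A"
  unfolding vertex_separation_def by blast

text \<open>One side of the separation is the set of vertices reachable from a fixed vertex after the
  removal of \<open>v\<close>, ignoring the direction of arcs.\<close>
lemma (in wf_digraph) vertex_separation_if_not_connected:
  assumes "v \<in> verts G" "verts G \<noteq> {v}" "\<not> connected (G \<restriction> (verts G - {v}))"
  obtains A B where "vertex_separation G v A B"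
proof -
  define H where "H = G \<restriction> (verts G - {v})"
  interpret H: wf_digraph H
    unfolding H_def by (rule wellformed_induce_subgraph)
  have verts_H: "verts H = verts G - {v}"
    by (simp add: H_def)
  have arcs_H: "x \<rightarrow>\<^bsub>H\<^esub> y \<longleftrightarrow> x \<rightarrow>\<^bsub>G\<^esub> y" if "x \<in> verts H" "y \<in> verts H" for x y
    using that by (auto simp: H_def arcs_ends_conv)
  let ?R = "rtrancl_on (verts H) ((arcs_ends H)\<^sup>s)"
  from assms verts_H obtain a b where ab: "a \<in> verts H" "b \<in> verts H" "(a, b) \<notin> ?R"
    unfolding H_def[symmetric] connected_conv by auto
  define A where "A = {w \<in> verts H. (a, w) \<in> ?R}"
  have closed: "y \<in> A" if "x \<in> A" "y \<in> verts H" "x \<rightarrow>\<^bsub>H\<^esub> y \<or> y \<rightarrow>\<^bsub>H\<^esub> x" for x y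
  proof -
    from that have "(x, y) \<in> (arcs_ends H)\<^sup>s"
      by (auto simp: symcl_def)
    with that show ?thesis
      unfolding A_def by (auto intro: rtrancl_on_into_rtrancl_on)
  qed
  have "vertex_separation G v A (verts H - A)"
    unfolding vertex_separation_def
  proof (intro conjI)
    show "A \<noteq> {}" using ab by (auto simp: A_def)
    show "verts H - A \<noteq> {}" using ab by (auto simp: A_def)
    show "A \<union> (verts H - A) = verts G - {v}" using verts_H by (auto simp: A_def)
    show "\<forall>x\<in>A. \<forall>y\<in>verts H - A. \<not> x \<rightarrow>\<^bsub>G\<^esub> y \<and> \<not> y \<rightarrow>\<^bsub>G\<^esub> x"
    proof (intro ballI)
      fix x y assume xy: "x \<in> A" "y \<in> verts H - A"
      moreover from xy have "x \<in> verts H" by (simp add: A_def)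
      ultimately show "\<not> x \<rightarrow>\<^bsub>G\<^esub> y \<and> \<not> y \<rightarrow>\<^bsub>G\<^esub> x"
        using closed[of x y] arcs_H by blast
    qed
  qed (use assms in auto)
  then show thesis by (rule that)
qed

context wf_digraph
begin

lemma awalk_through_separator:
  assumes sep: "vertex_separation G v A B"
    and "awalk x p y" "x \<in> A" "y \<in> B"
  shows "v \<in> set (awalk_verts x p)"
  using assms(2,3)
proof (induct p arbitrary: x)
  case Nil
  then show ?case using sep \<open>y \<in> B\<close> by (auto simp: vertex_separation_def awalk_Nil_iff)
next
  case (Cons e p)
  then have e: "e \<in> arcs G" "x = tail G e" "awalk (head G e) p y"
    by (auto simp: awalk_Cons_iff)
  show ?case
  proof (cases "head G e = v")
    case True
    then show ?thesis using e by (auto dest: hd_in_awalk_verts)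
  next
    case False
    moreover have "tail G e \<rightarrow>\<^bsub>G\<^esub> head G e"
      using e by (auto intro: in_arcs_imp_in_arcs_ends)
    ultimately have "head G e \<in> A"
      using sep e Cons.prems(2) unfolding vertex_separation_def
      by (metis Un_iff Diff_iff head_in_verts singletonD)
    then show ?thesis using Cons.hyps[of "head G e"] e by auto
  qed
qed

lemma graph_dist_separation:
  assumes "vertex_separation G v A B" "x \<in> A" "y \<in> B"
  shows "graph_dist G x v + graph_dist G v y \<le> graph_dist G x y"
proof (rule graph_dist_greatest)
  fix p assume p: "awalk x p y"
  from awalk_decomp[OF p awalk_through_separator[OF assms(1) p assms(2,3)]]
  obtain q r where qr: "p = q @ r" "awalk x q v" "awalk v r y"
    by (elim exE conjE)
  have "graph_dist G x v + graph_dist G v y \<le> ereal (real (length q)) + ereal (real (length r))"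
    by (intro add_mono graph_dist_le_length qr)
  then show "graph_dist G x v + graph_dist G v y \<le> ereal (real (length p))"
    using qr by simp
qed

end

lemma graph_dist_le_diameter:
  "u \<in> verts G \<Longrightarrow> v \<in> verts G \<Longrightarrow> graph_dist G u v \<le> graph_diameter G"
  unfolding graph_diameter_def by (rule SUP_upper2[of u], assumption, rule SUP_upper2[of v]) auto

text \<open>Two vertices on different sides that are both at distance at least \<open>2\<close> from the separating
  vertex are at distance at least \<open>4\<close> from each other.\<close>
lemma (in sym_digraph) separation_side_adjacent:
  assumes sep: "vertex_separation G v A B" and diam: "graph_diameter G \<le> 3"
  shows "(\<forall>a\<in>A. a \<rightarrow>\<^bsub>G\<^esub> v) \<or> (\<forall>b\<in>B. b \<rightarrow>\<^bsub>G\<^esub> v)"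
proof (rule ccontr)
  assume "\<not> ?thesis"
  then obtain a b where ab: "a \<in> A" "b \<in> B" "\<not> a \<rightarrow>\<^bsub>G\<^esub> v" "\<not> b \<rightarrow>\<^bsub>G\<^esub> v"
    by blast
  then have verts: "a \<in> verts G" "b \<in> verts G" "a \<noteq> v" "b \<noteq> v"
    using sep unfolding vertex_separation_def by blast+
  have "\<not> v \<rightarrow>\<^bsub>G\<^esub> b"
    using ab(4) arcs_ends_symmetric[OF sym_arcs] by metis
  then have "2 + 2 \<le> graph_dist G a v + graph_dist G v b"
    using ab verts by (intro add_mono graph_dist_ge_2) auto
  also have "\<dots> \<le> graph_dist G a b"
    using sep ab by (intro graph_dist_separation)
  also have "\<dots> \<le> 3"
    using graph_dist_le_diameter[OF verts(1,2)] diam by (rule order_trans)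
  finally show False by simp
qed

section \<open>Harmonic centrality at a separating vertex\<close>

text \<open>The centralities are compared vertex by vertex: for a vertex other than \<open>u\<close> and \<open>v\<close> the
  contribution to \<open>v\<close> is at least the one to \<open>u\<close>, and strictly larger on the side \<open>B\<close>, which
  is nonempty. Strong connectedness makes all distances finite; an infinite distance would be
  converted to the real number \<open>0\<close> and spoil the comparison.\<close>
lemma (in fin_digraph) harmonic_centrality_less_cutvertex:
  assumes sc: "strongly_connected G"
    and sep: "vertex_separation G v A B"
    and adj: "\<And>a. a \<in> A \<Longrightarrow> a \<rightarrow>\<^bsub>G\<^esub> v"
    and u: "u \<in> A"
  shows "harmonic_centrality G u < harmonic_centrality G v"
proof -
  define d where "d x y = real_of_ereal (graph_dist G x y)" for x y
  have d: "graph_dist G x y = ereal (d x y)" if "x \<in> verts G" "y \<in> verts G" for x y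
  proof -
    have "x \<rightarrow>\<^sup>* y" using sc that by (simp add: strongly_connected_def)
    from graph_dist_finite[OF this] show ?thesis by (auto simp: d_def)
  qed
  have d_ge_1: "1 \<le> d x y" if "x \<in> verts G" "y \<in> verts G" "x \<noteq> y" for x y
    using graph_dist_ge_1[OF that(3)] d[OF that(1,2)] by simp
  have d_adj: "d a v = 1" if "a \<in> A" for a
  proof -
    have "a \<noteq> v" using sep that unfolding vertex_separation_def by blast
    then show ?thesis using graph_dist_adjacent adj that by (simp add: d_def)
  qed
  have v: "v \<in> verts G" and A: "A \<subseteq> verts G - {v}" and B: "B \<subseteq> verts G - {v}"
    and disj: "A \<inter> B = {}" and un: "verts G - {v} = A \<union> B" and ne: "B \<noteq> {}"
    using sep unfolding vertex_separation_def by auto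
  have uv: "u \<noteq> v" "u \<in> verts G" using u A by auto
  let ?W = "verts G - {u, v}"
  have far: "1 / d w u < 1 / d w v" if "w \<in> B" for w
  proof -
    have w: "w \<in> verts G" "w \<noteq> v" using that B by auto
    have "d w v + d v u \<le> d w u"
      using graph_dist_separation[OF vertex_separation_sym[OF sep] that u] d w v uv by simp
    moreover have "1 \<le> d v u" "1 \<le> d w v" using d_ge_1 w v uv by auto
    ultimately show ?thesis by (simp add: frac_less2)
  qed
  have near: "1 / d w u \<le> 1 / d w v" if "w \<in> ?W" for w
  proof (cases "w \<in> B")
    case True
    then show ?thesis using far by (simp add: less_imp_le)
  next
    case False
    then have "w \<in> A" using that un by blast
    then show ?thesis using d_adj d_ge_1[of w u] uv that by (simp add: divide_le_eq_1)
  qed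
  have "(\<Sum>w\<in>?W. 1 / d w u) < (\<Sum>w\<in>?W. 1 / d w v)"
  proof (rule sum_strict_mono_ex1)
    obtain w where "w \<in> B" using ne by blast
    moreover from this have "w \<in> ?W" using B disj u by blast
    ultimately show "\<exists>w\<in>?W. 1 / d w u < 1 / d w v" using far by blast
  qed (use near in auto)
  \<comment> \<open>the contributions of \<open>u\<close> and \<open>v\<close> to each other\<close>
  moreover have "1 / d v u \<le> 1 / d u v"
    using d_adj[OF u] d_ge_1[of v u] uv v by (simp add: divide_le_eq_1)
  moreover have "harmonic_centrality G u = 1 / d v u + (\<Sum>w\<in>?W. 1 / d w u)"
  proof -
    have eq: "verts G - {u} = insert v ?W" using uv v by blast
    show ?thesis
      unfolding harmonic_centrality_def d_def[symmetric] eq using uv by (subst sum.insert) auto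
  qed
  moreover have "harmonic_centrality G v = 1 / d u v + (\<Sum>w\<in>?W. 1 / d w v)"
  proof -
    have eq: "verts G - {v} = insert u ?W" using uv by blast
    show ?thesis
      unfolding harmonic_centrality_def d_def[symmetric] eq using uv by (subst sum.insert) auto
  qed
  ultimately show ?thesis by linarith
qed

theorem corollary1:
  fixes G :: "('a, 'b) pre_digraph"
  assumes "graph G"
    and "connected G"
    and "harmonic_uniform G"
    and "3 \<le> card (verts G)"
    and "graph_diameter G \<le> 3"
  shows "k_connected 2 G"
proof -
  interpret graph G by fact
  have sc: "strongly_connected G"
    using symmetric_connected_imp_strongly_connected[OF sym_arcs \<open>connected G\<close>] .
  have uniform: "harmonic_centrality G x = harmonic_centrality G y"
    if "x \<in> verts G" "y \<in> verts G" for x y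
    using \<open>harmonic_uniform G\<close> harmonic_uniform_iff[OF \<open>graph G\<close>] that by blast
  have no_separation: False if sep: "vertex_separation G v A B" for v A B
  proof -
    have no_adjacent_side: False
      if sepA: "vertex_separation G v A B" and adjA: "\<forall>a\<in>A. a \<rightarrow>\<^bsub>G\<^esub> v" for A B
    proof -
      obtain u where "u \<in> A" "u \<in> verts G" "v \<in> verts G"
        using sepA unfolding vertex_separation_def by blast
      then show False
        using harmonic_centrality_less_cutvertex[OF sc sepA, of u] adjA uniform[of u v]
        by simp
    qed
    show False
      using separation_side_adjacent[OF sep \<open>graph_diameter G \<le> 3\<close>]
        no_adjacent_side sep vertex_separation_sym[OF sep] by blast
  qed
  show ?thesis
    unfolding k_connected_def
  proof (intro conjI allI impI; (elim conjE)?)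
    fix X assume X: "X \<subseteq> verts G" "card X < 2"
    then have "finite X" by (auto intro: finite_subset)
    with X consider "X = {}" | v where "X = {v}"
      by (metis One_nat_def card_0_eq card_1_singletonE less_2_cases)
    then show "connected (G \<restriction> (verts G - X))"
    proof cases
      case 1
      have "G \<restriction> verts G = G"
        by (intro pre_digraph.equality) (auto simp: induce_subgraph_def)
      then show ?thesis using 1 \<open>connected G\<close> by simp
    next
      case 2
      moreover have "verts G \<noteq> {v}"
        using \<open>3 \<le> card (verts G)\<close> by auto
      ultimately show ?thesis
        using vertex_separation_if_not_connected[of v] no_separation X by blast
    qed
  qed (use \<open>3 \<le> card (verts G)\<close> in simp)
qed

end
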